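(* For every strict complete preference profile of size $n$ with $1\le n\le 4$, there exist a set of men $S_m$ and a set of women $S_w$ satisfying conditions (H1) and (H2) (defined in the context) with $$|S_m|\,|S_w|\ \ge\ \left\lfloor\frac{(n-1)^2}{4}\right\rfloor .$$
   Context: In a profile of size $n$ there are $n$ men and $n$ women, each with a strict complete preference order on the other side; $r_M(i,j)\in\{1,\dots,n\}$ is the rank of woman $j$ in man $i$'s list and $r_W(j,i)\in\{1,\dots,n\}$ the rank of man $i$ in woman $j$'s list (1 is best). For a set of men $S_m$ and a set of women $S_w$ (possibly empty), let $T_w$ be the set of women not in $S_w$ and $T_m$ the set of men not in $S_m$. The maximum over an empty set of ranks is read as $0$. (H1): the bipartite graph on $(S_m,T_w)$ with $i\sim w$ iff $r_M(i,w)>\max_{j\in S_w}r_M(i,j)$ has a matching saturating $S_m$. (H2): the bipartite graph on $(S_w,T_m)$ with $j\sim i'$ iff $r_W(j,i')>\max_{i\in S_m}r_W(j,i)$ has a matching saturating $S_w$. *)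

theory Defs
  imports Complex_Main
begin

(* Men and women are both indexed by {1..n}. A strict complete preference order of an agent x on
   the other side is given by its rank function r x, where rank 1 is best: the order is strict
   and complete exactly when r x is a bijection onto {1..n}. *)
definition strict_complete_ranks :: "nat \<Rightarrow> (nat \<Rightarrow> nat \<Rightarrow> nat) \<Rightarrow> bool" where
  "strict_complete_ranks n r \<longleftrightarrow> (\<forall>x\<in>{1..n}. bij_betw (r x) {1..n} {1..n})"

(* In rM i j the man i ranks the woman j; in rW j i the woman j ranks the man i. *)
definition preference_profile ::
  "nat \<Rightarrow> (nat \<Rightarrow> nat \<Rightarrow> nat) \<Rightarrow> (nat \<Rightarrow> nat \<Rightarrow> nat) \<Rightarrow> bool" where
  "preference_profile n rM rW \<longleftrightarrow> strict_complete_ranks n rM \<and> strict_complete_ranks n rW"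

definition max_rank :: "nat set \<Rightarrow> nat" where
  "max_rank R = (if R = {} then 0 else Max R)"

(* A bipartite graph is given by its edges (x, y), with x in the left part and y in the right
   part. The parts are disjoint as vertex sets even when their indices coincide, so two edges
   share a vertex only if they agree in the same component. *)
definition bip_matching :: "('a \<times> 'b) set \<Rightarrow> ('a \<times> 'b) set \<Rightarrow> bool" where
  "bip_matching E M \<longleftrightarrow>
     M \<subseteq> E \<and> (\<forall>e\<in>M. \<forall>f\<in>M. e \<noteq> f \<longrightarrow> fst e \<noteq> fst f \<and> snd e \<noteq> snd f)"

definition has_left_saturating_matching :: "'a set \<Rightarrow> ('a \<times> 'b) set \<Rightarrow> bool" where
  "has_left_saturating_matching A E \<longleftrightarrow> (\<exists>M. bip_matching E M \<and> A \<subseteq> fst ` M)"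

(* S is a set of agents on one side with rank functions r, and S' a set of agents on the other
   side; the right part consists of the agents of the other side that are not in S'. *)
definition worse_graph ::
  "nat \<Rightarrow> (nat \<Rightarrow> nat \<Rightarrow> nat) \<Rightarrow> nat set \<Rightarrow> nat set \<Rightarrow> (nat \<times> nat) set" where
  "worse_graph n r S S' = {(x, y). x \<in> S \<and> y \<in> {1..n} - S' \<and> r x y > max_rank (r x ` S')}"

definition H1 :: "nat \<Rightarrow> (nat \<Rightarrow> nat \<Rightarrow> nat) \<Rightarrow> nat set \<Rightarrow> nat set \<Rightarrow> bool" where
  "H1 n rM Sm Sw \<longleftrightarrow> has_left_saturating_matching Sm (worse_graph n rM Sm Sw)"

definition H2 :: "nat \<Rightarrow> (nat \<Rightarrow> nat \<Rightarrow> nat) \<Rightarrow> nat set \<Rightarrow> nat set \<Rightarrow> bool" where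
  "H2 n rW Sm Sw \<longleftrightarrow> has_left_saturating_matching Sw (worse_graph n rW Sw Sm)"

end

(* For n <= 2 the empty sets work, and for n = 3 a single pair (i, j) with neither agent ranked last
   by the other, which exists since at most 2n < n^2 pairs fail. For n = 4 one man i and two women
   j, k suffice, provided that i ranks neither woman last, k does not rank i last, and j ranks i
   above her last two: k is matched to her last man, and j to whichever of her last two men differs
   from him. Counting the pairs that are excluded by some "last" position, there are at least
   n(n - 3) >= n pairs of the kind (i, j) and n(n - 2) > n of the kind (i, k), so one man lies in
   a pair of the first kind and in another pair of the second kind. *)
theory Submission
  imports Defs
begin

lemma has_left_saturating_matching_injI:
  assumes "inj_on f A" and "\<And>x. x \<in> A \<Longrightarrow> (x, f x) \<in> E"
  shows "has_left_saturating_matching A E"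
  unfolding has_left_saturating_matching_def
proof (intro exI conjI)
  show "bip_matching E ((\<lambda>x. (x, f x)) ` A)"
    using assms unfolding bip_matching_def inj_on_def by auto
  show "A \<subseteq> fst ` (\<lambda>x. (x, f x)) ` A"
    by force
qed

lemma strict_complete_ranksD:
  assumes "strict_complete_ranks n r" and "x \<in> {1..n}"
  shows "bij_betw (r x) {1..n} {1..n}"
  using assms by (simp add: strict_complete_ranks_def)

lemma strict_complete_ranks_obtain:
  assumes "strict_complete_ranks n r" and "x \<in> {1..n}" and "k \<in> {1..n}"
  obtains y where "y \<in> {1..n}" and "r x y = k"
  using strict_complete_ranksD[OF assms(1,2)] assms(3) unfolding bij_betw_def by (metis imageE)

lemma card_rank_le:
  assumes "strict_complete_ranks n r" and "x \<in> {1..n}" and "a \<le> n"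
  shows "card {y \<in> {1..n}. r x y \<le> a} = a"
proof -
  have b: "bij_betw (r x) {1..n} {1..n}"
    using strict_complete_ranksD[OF assms(1,2)] .
  have "r x ` {y \<in> {1..n}. r x y \<le> a} = {y \<in> r x ` {1..n}. y \<le> a}"
    by auto
  also have "\<dots> = {1..a}"
    using b assms(3) by (auto simp: bij_betw_def)
  finally have "card (r x ` {y \<in> {1..n}. r x y \<le> a}) = a"
    by simp
  moreover have "inj_on (r x) {y \<in> {1..n}. r x y \<le> a}"
    using b by (auto simp: bij_betw_def intro: inj_on_subset)
  ultimately show ?thesis
    by (simp add: card_image)
qed

text \<open>The maximum is replaced by a comparison with each element of \<open>S'\<close>.
  Positivity of \<open>r x (f x)\<close> covers the empty \<open>S'\<close>, where
  \<open>max_rank\<close> is 0, and \<open>f x\<close> lies outside \<open>S'\<close> because its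
  rank would otherwise be below itself.\<close>

lemma saturating_worse_graphI:
  assumes "inj_on f S" and "finite S'"
    and "\<And>x. x \<in> S \<Longrightarrow> f x \<in> {1..n}"
    and "\<And>x. x \<in> S \<Longrightarrow> 0 < r x (f x)"
    and "\<And>x z. x \<in> S \<Longrightarrow> z \<in> S' \<Longrightarrow> r x z < r x (f x)"
  shows "has_left_saturating_matching S (worse_graph n r S S')"
proof (rule has_left_saturating_matching_injI[OF assms(1)])
  fix x assume x: "x \<in> S"
  have "f x \<notin> S'"
    using assms(5)[OF x] by blast
  moreover have "max_rank (r x ` S') < r x (f x)"
    using assms(2) assms(4,5)[OF x] by (simp add: max_rank_def)
  ultimately show "(x, f x) \<in> worse_graph n r S S'"
    using x assms(3)[OF x] by (simp add: worse_graph_def)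
qed

text \<open>A lone agent is matched to the agent it ranks last, so \<open>S'\<close> only has to
  avoid that one.\<close>

lemma worse_graph_singleton:
  assumes "strict_complete_ranks n r" and "x \<in> {1..n}" and "finite S'"
    and "\<And>z. z \<in> S' \<Longrightarrow> r x z < n"
  shows "has_left_saturating_matching {x} (worse_graph n r {x} S')"
proof -
  obtain y where "y \<in> {1..n}" "r x y = n"
    using strict_complete_ranks_obtain[OF assms(1,2), of n] assms(2) by auto
  then show ?thesis
    using assms by (intro saturating_worse_graphI[where f = "\<lambda>_. y"]) auto
qed

lemma worse_graph_pair:
  assumes r: "strict_complete_ranks n r"
    and j: "j \<in> {1..n}" "r j i < n - 1" and k: "k \<in> {1..n}" "r k i < n" and "j \<noteq> k"
  shows "has_left_saturating_matching {j, k} (worse_graph n r {j, k} {i})"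
proof -
  obtain v where v: "v \<in> {1..n}" "r k v = n"
    using strict_complete_ranks_obtain[OF r k(1), of n] k(1) by auto
  obtain u1 where u1: "u1 \<in> {1..n}" "r j u1 = n"
    using strict_complete_ranks_obtain[OF r j(1), of n] j(1) by auto
  \<comment> \<open>Rank \<open>n - 1\<close> is attained because \<open>r j i < n - 1\<close> makes
    it positive.\<close>
  obtain u2 where u2: "u2 \<in> {1..n}" "r j u2 = n - 1"
    using strict_complete_ranks_obtain[OF r j(1), of "n - 1"] j by auto
  have "u1 \<noteq> u2"
    using u1 u2 j by auto
  then obtain u where u: "u \<in> {1..n}" "u \<noteq> v" "n - 1 \<le> r j u"
    using u1 u2 by (metis diff_le_self order_refl)
  show ?thesis
    using u v j k \<open>j \<noteq> k\<close>
    by (intro saturating_worse_graphI[where f = "\<lambda>x. if x = j then u else v"])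
      (auto simp: inj_on_def)
qed

text \<open>Inclusion-exclusion inside the \<open>n\<close> women for each man, summed over all men.
  The term \<open>n * n\<close> stands on the right to avoid truncated subtraction.\<close>

lemma sum_card_mutual_ranks:
  assumes rM: "strict_complete_ranks n rM" and rW: "strict_complete_ranks n rW"
    and a: "a \<le> n" and b: "b \<le> n"
  shows "n * a + n * b \<le> (\<Sum>i\<in>{1..n}. card {j \<in> {1..n}. rM i j \<le> a \<and> rW j i \<le> b}) + n * n"
proof -
  let ?A = "\<lambda>i. {j \<in> {1..n}. rM i j \<le> a}"
  let ?B = "\<lambda>i. {j \<in> {1..n}. rW j i \<le> b}"
  let ?C = "\<lambda>i. {j \<in> {1..n}. rM i j \<le> a \<and> rW j i \<le> b}"
  have le: "card (?A i) + card (?B i) \<le> card (?C i) + n" for i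
  proof -
    have "card (?A i) + card (?B i) = card (?A i \<union> ?B i) + card (?A i \<inter> ?B i)"
      by (rule card_Un_Int) auto
    moreover have "?A i \<inter> ?B i = ?C i"
      by auto
    moreover have "card (?A i \<union> ?B i) \<le> card {1..n}"
      by (intro card_mono) auto
    ultimately show ?thesis
      by simp
  qed
  \<comment> \<open>A single \<open>?B i\<close> can have any size, but counting the same pairs from
    the women's side gives exactly \<open>b\<close> men for each woman.\<close>
  have "(\<Sum>i\<in>{1..n}. card (?B i)) = (\<Sum>j\<in>{1..n}. card {i \<in> {1..n}. rW j i \<le> b})"
    by (intro sum_multicount_gen) auto
  also have "\<dots> = n * b"
    using card_rank_le[OF rW _ b] by simp
  finally have sB: "(\<Sum>i\<in>{1..n}. card (?B i)) = n * b" .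
  have sA: "(\<Sum>i\<in>{1..n}. card (?A i)) = n * a"
    using card_rank_le[OF rM _ a] by simp
  have "(\<Sum>i\<in>{1..n}. card (?A i) + card (?B i)) \<le> (\<Sum>i\<in>{1..n}. card (?C i) + n)"
    by (intro sum_mono le)
  then show ?thesis
    by (simp only: sum.distrib sA sB) simp
qed

lemma mutually_not_last_pair:
  assumes rM: "strict_complete_ranks n rM" and rW: "strict_complete_ranks n rW" and n: "3 \<le> n"
  shows "\<exists>i\<in>{1..n}. \<exists>j\<in>{1..n}. rM i j < n \<and> rW j i < n"
proof (rule ccontr)
  assume "\<not> ?thesis"
  then have none: "\<not> (rM i j < n \<and> rW j i < n)" if "i \<in> {1..n}" "j \<in> {1..n}" for i j
    using that by blast
  have "card {j \<in> {1..n}. rM i j \<le> n - 1 \<and> rW j i \<le> n - 1} = 0" if "i \<in> {1..n}" for i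
    using none[OF that] n by (fastforce simp: card_eq_0_iff)
  then have "(\<Sum>i\<in>{1..n}. card {j \<in> {1..n}. rM i j \<le> n - 1 \<and> rW j i \<le> n - 1}) = 0"
    by (intro sum.neutral) blast
  then have "n * (n - 1) + n * (n - 1) \<le> n * n"
    using sum_card_mutual_ranks[OF rM rW diff_le_self diff_le_self, of 1 1] by linarith
  then have "n * (2 * (n - 1)) \<le> n * n"
    by (simp add: algebra_simps)
  then show False
    using n by simp
qed

lemma two_women_one_man:
  assumes rM: "strict_complete_ranks n rM" and rW: "strict_complete_ranks n rW" and n: "4 \<le> n"
  obtains i j k where "i \<in> {1..n}" "j \<in> {1..n}" "k \<in> {1..n}" "j \<noteq> k"
    "rM i j < n" "rM i k < n" "rW j i < n - 1" "rW k i < n"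
proof -
  let ?G = "\<lambda>i. {j \<in> {1..n}. rM i j \<le> n - 1 \<and> rW j i \<le> n - 1}"
  let ?S = "\<lambda>i. {j \<in> {1..n}. rM i j \<le> n - 1 \<and> rW j i \<le> n - 2}"
  \<comment> \<open>Such a man suffices: take \<open>j\<close> from \<open>?S i\<close>, and a
    second element of \<open>?G i\<close> as \<open>k\<close>.\<close>
  have "\<exists>i\<in>{1..n}. 1 \<le> card (?S i) \<and> 2 \<le> card (?G i)"
  proof (rule ccontr)
    assume none: "\<not> ?thesis"
    have bad: "card (?S i) = 0 \<or> card (?G i) \<le> 1" if "i \<in> {1..n}" for i
    proof -
      have "\<not> (1 \<le> card (?S i) \<and> 2 \<le> card (?G i))"
        using none that by blast
      then show ?thesis
        by linarith
    qed
    have SG: "card (?S i) \<le> card (?G i)" for i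
      by (intro card_mono) auto
    \<comment> \<open>Two elements of \<open>?S i\<close> would also be two elements of
      \<open>?G i\<close>, which \<open>bad\<close> forbids.\<close>
    have S1: "card (?S i) \<le> 1" if "i \<in> {1..n}" for i
      using bad[OF that] SG[of i] by linarith
    have "n * (n - 1) + n * (n - 2) \<le> (\<Sum>i\<in>{1..n}. card (?S i)) + n * n"
      using sum_card_mutual_ranks[OF rM rW, of "n - 1" "n - 2"] by simp
    moreover have "n * n + n \<le> n * (n - 1) + n * (n - 2)"
    proof -
      \<comment> \<open>The inequality n + 1 \<le> 2n - 3 is exactly n \<ge> 4.\<close>
      have "n * (n + 1) \<le> n * ((n - 1) + (n - 2))"
        using n by (intro mult_le_mono) auto
      then show ?thesis
        by (simp only: distrib_left mult_1_right)
    qed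
    ultimately have Sn: "n \<le> (\<Sum>i\<in>{1..n}. card (?S i))"
      by linarith
    \<comment> \<open>There are \<open>n\<close> terms, each at most 1, with sum at least
      \<open>n\<close>, so none can be 0. Hence \<open>bad\<close> bounds every \<open>?G i\<close>
      by 1.\<close>
    have S_eq: "card (?S i) = 1" if i: "i \<in> {1..n}" for i
    proof (rule ccontr)
      assume "card (?S i) \<noteq> 1"
      then have "card (?S i) < 1"
        using S1[OF i] by linarith
      then have "(\<Sum>i\<in>{1..n}. card (?S i)) < (\<Sum>i\<in>{1..n}. 1)"
        using S1 i by (intro sum_strict_mono_ex1) auto
      then show False
        using Sn by simp
    qed
    then have "card (?G i) \<le> 1" if "i \<in> {1..n}" for i
      using bad[OF that] that by (metis one_neq_zero)
    then have "(\<Sum>i\<in>{1..n}. card (?G i)) \<le> (\<Sum>i\<in>{1..n}. 1)"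
      by (intro sum_mono)
    \<comment> \<open>The \<open>?G i\<close> now contain at most \<open>n\<close> pairs in total,
      whereas the counting bound demands n(n - 2), which is larger for n > 3.\<close>
    then have "n * (n - 1) + n * (n - 1) \<le> n + n * n"
      using sum_card_mutual_ranks[OF rM rW, of "n - 1" "n - 1"] by simp
    then have "n * (2 * (n - 1)) \<le> n * (n + 1)"
      by (simp add: algebra_simps)
    then have "2 * (n - 1) \<le> n + 1"
      using n by (simp only: nat_mult_le_cancel_disj)
    then show False
      using n by linarith
  qed
  then obtain i where i: "i \<in> {1..n}" and cS: "1 \<le> card (?S i)" and cG: "2 \<le> card (?G i)"
    by blast
  from cS obtain j where j: "j \<in> ?S i"
    by (metis (no_types, lifting) card.empty equals0I not_one_le_zero)
  have "\<not> ?G i \<subseteq> {j}"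
    using cG card_mono[of "{j}" "?G i"] by auto
  then obtain k where "k \<in> ?G i" "k \<noteq> j"
    by blast
  with i j show thesis
    using n by (intro that[of i j k]) auto
qed

theorem proposition6p7:
  fixes n :: nat and rM rW :: "nat \<Rightarrow> nat \<Rightarrow> nat"
  assumes "1 \<le> n" and "n \<le> 4"
    and "preference_profile n rM rW"
  shows "\<exists>Sm Sw. Sm \<subseteq> {1..n} \<and> Sw \<subseteq> {1..n} \<and> H1 n rM Sm Sw \<and> H2 n rW Sm Sw \<and>
           int (card Sm * card Sw) \<ge> \<lfloor>(real n - 1)\<^sup>2 / 4\<rfloor>"
proof -
  have rM: "strict_complete_ranks n rM" and rW: "strict_complete_ranks n rW"
    using assms(3) by (auto simp: preference_profile_def)
  consider "n = 1 \<or> n = 2" | "n = 3" | "n = 4"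
    using assms(1,2) by linarith
  then show ?thesis
  proof cases
    case 1
    have "H1 n rM {} {}" "H2 n rW {} {}"
      unfolding H1_def H2_def by (auto intro: saturating_worse_graphI[where f = id])
    \<comment> \<open>The quotient is 0 or 1/4 here; it is 1 for n = 3 and 9/4 for n = 4, so the
      products needed are 0, 1 and 2.\<close>
    moreover have "\<lfloor>(real n - 1)\<^sup>2 / 4\<rfloor> \<le> 0"
      using 1 by (auto simp: floor_le_iff)
    ultimately show ?thesis
      by (intro exI[of _ "{}"]) simp
  next
    case 2
    then obtain i j where ij: "i \<in> {1..n}" "j \<in> {1..n}" "rM i j < n" "rW j i < n"
      using mutually_not_last_pair[OF rM rW] by auto
    have "H1 n rM {i} {j}" "H2 n rW {i} {j}"
      unfolding H1_def H2_def
      using ij by (auto intro!: worse_graph_singleton rM rW)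
    moreover have "\<lfloor>(real n - 1)\<^sup>2 / 4\<rfloor> \<le> 1"
      using 2 by (simp add: floor_le_iff)
    ultimately show ?thesis
      using ij by (intro exI[of _ "{i}"] exI[of _ "{j}"]) simp
  next
    case 3
    then obtain i j k where ijk: "i \<in> {1..n}" "j \<in> {1..n}" "k \<in> {1..n}" "j \<noteq> k"
      "rM i j < n" "rM i k < n" "rW j i < n - 1" "rW k i < n"
      using two_women_one_man[OF rM rW] by auto
    have "H1 n rM {i} {j, k}"
      unfolding H1_def using ijk by (intro worse_graph_singleton rM) auto
    moreover have "H2 n rW {i} {j, k}"
      unfolding H2_def using ijk by (intro worse_graph_pair rW) auto
    moreover have "\<lfloor>(real n - 1)\<^sup>2 / 4\<rfloor> \<le> 2"
      using 3 by (simp add: floor_le_iff power2_eq_square)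
    ultimately show ?thesis
      using ijk by (intro exI[of _ "{i}"] exI[of _ "{j, k}"]) simp
  qed
qed

end
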